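(* Let $T$ be a ptableau with $n$ rows having $\ell$ columns, and let $\widehat T$ be its dual. Then for each $k$ with $1\le k\le \ell$, column $\ell-k+1$ of the right-justified form $T^*$ is dual to column $k$ of the left-justified form ${}^*\widehat T$: a cell with content $s$ in row $t$ lies in column $\ell-k+1$ of $T^*$ if and only if a cell with content $t$ in row $s$ lies in column $k$ of ${}^*\widehat T$. (In particular $T$ and $\widehat T$ have the same number of columns.)
   Context: Ptableaux. A perforated tableau (ptableau) with $n$ rows is a rectangular array with $n$ rows (numbered from top) in which every box either contains a positive integer (a cell, with that content) or is blank, such that: (a) for each positive integer $i$ the cells with content $i$ form a horizontal strip; (b) if $i<j$, no cell with content $j$ lies in a row strictly above, or in a column strictly to the left of, any cell with content $i$; (c) the number of columns is minimal subject to (a),(b) (no column is entirely blank; blank rows allowed). Two ptableaux are row-equivalent if one is obtained from the other by finitely many swaps of a blank with an adjacent cell in the same row, each producing a ptableau; ptableaux are identified up to row-equivalence, and a ptableau is determined by the multiset of pairs (content, row) of its cells. All ptableaux in a row-equivalence class have the same number of columns. The left-justified form ${}^*T$ (resp. right-justified form $T^*$) is the row-equivalent ptableau with all content as far left (resp. right) as possible. Columns are numbered $1,2,\dots$ from left to right. Dual: $\widehat T$ is the ptableau having a cell with content $j$ in row $i$ for each cell of $T$ with content $i$ in row $j$ (its number of rows is the largest content of $T$).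
   Formalization: Condition (b) is read as: for i<j, no cell with content j lies weakly above and weakly to the left of a cell with content i; taken as separate conditions on rows and on columns, the claim fails for two 1s in row 1 and two 2s in row 2. *)

theory Defs
  imports Main "HOL-Library.Multiset"
begin

text \<open>
  Rows and columns are numbered from 1, rows from the top and columns from the left.
  \<open>entry A r c\<close> is \<open>Some s\<close> if the box in row \<open>r\<close> and column \<open>c\<close> is a cell with content \<open>s\<close>,
  and \<open>None\<close> if it is blank (or outside the rectangle).
\<close>

record box_array =
  nrows :: nat
  ncols :: nat
  entry :: "nat \<Rightarrow> nat \<Rightarrow> nat option"

definition is_array :: "box_array \<Rightarrow> bool" where
  "is_array A \<longleftrightarrow> (\<forall>r c s. entry A r c = Some s \<longrightarrow>
     1 \<le> r \<and> r \<le> nrows A \<and> 1 \<le> c \<and> c \<le> ncols A \<and> 1 \<le> s)"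

definition cells :: "box_array \<Rightarrow> (nat \<times> nat) set" where
  "cells A = {(r, c). entry A r c \<noteq> None}"

definition cells_with_content :: "box_array \<Rightarrow> nat \<Rightarrow> (nat \<times> nat) set" where
  "cells_with_content A i = {(r, c). entry A r c = Some i}"

text \<open>The multiset of pairs (content, row) of the cells.\<close>

definition cell_mset :: "box_array \<Rightarrow> (nat \<times> nat) multiset" where
  "cell_mset A = image_mset (\<lambda>(r, c). (the (entry A r c), r)) (mset_set (cells A))"

text \<open>
  As for skew shapes, where the boxes of a lower row of a horizontal strip lie strictly to the
  left of those of a higher row; in particular no two boxes share a column. Gaps within a row
  are allowed.
\<close>

definition horizontal_strip :: "(nat \<times> nat) set \<Rightarrow> bool" where
  "horizontal_strip S \<longleftrightarrow> (\<forall>(r, c)\<in>S. \<forall>(r', c')\<in>S. r < r' \<longrightarrow> c' < c)"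

text \<open>
  Condition (b) for ptableaux: for \<open>i < j\<close>, no \<open>j\<close> lies strictly above (and not to the right of)
  an \<open>i\<close>, nor strictly to the left of (and not below) an \<open>i\<close>. Two distinct cells never occupy
  the same box, so this says that no \<open>j\<close> lies weakly above and weakly to the left of an \<open>i\<close>.
  The two directions must be combined in this way: a \<open>j\<close> that is above but further right than
  an \<open>i\<close>, or further left but below it, is permitted, as in ordinary tableaux.
\<close>

definition content_ordered :: "box_array \<Rightarrow> bool" where
  "content_ordered A \<longleftrightarrow> (\<forall>i j r c r' c'. i < j \<and>
     (r, c) \<in> cells_with_content A i \<and> (r', c') \<in> cells_with_content A j \<longrightarrow>
     \<not> (r' < r \<and> c' \<le> c) \<and> \<not> (c' < c \<and> r' \<le> r))"

definition preptableau :: "box_array \<Rightarrow> bool" where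
  "preptableau A \<longleftrightarrow> is_array A \<and>
     (\<forall>i. horizontal_strip (cells_with_content A i)) \<and> content_ordered A"

text \<open>
  The number of columns is minimal among all arrays with the same rows (as multisets of
  contents). Hence no column is entirely blank, as a blank column could be deleted.
\<close>

definition ptableau :: "box_array \<Rightarrow> bool" where
  "ptableau T \<longleftrightarrow> preptableau T \<and>
     (\<forall>A. preptableau A \<and> nrows A = nrows T \<and> cell_mset A = cell_mset T \<longrightarrow>
        ncols T \<le> ncols A)"

definition swap_step :: "box_array \<Rightarrow> box_array \<Rightarrow> bool" where
  "swap_step T T' \<longleftrightarrow> ptableau T \<and> ptableau T' \<and>
     nrows T' = nrows T \<and> ncols T' = ncols T \<and>
     (\<exists>r c c'. 1 \<le> r \<and> r \<le> nrows T \<and>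
        1 \<le> c \<and> c \<le> ncols T \<and> 1 \<le> c' \<and> c' \<le> ncols T \<and>
        (c' = Suc c \<or> c = Suc c') \<and>
        entry T r c \<noteq> None \<and> entry T r c' = None \<and>
        entry T' = (entry T)(r := (entry T r)(c := None, c' := entry T r c)))"

text \<open>\<open>swap_step\<close> is symmetric, so this is an equivalence relation on ptableaux.\<close>

definition row_equiv :: "box_array \<Rightarrow> box_array \<Rightarrow> bool" where
  "row_equiv = swap_step\<^sup>*\<^sup>*"

text \<open>The number of cells with content \<open>s\<close> in row \<open>r\<close> among the first \<open>c\<close> columns.\<close>

definition cells_upto :: "box_array \<Rightarrow> nat \<Rightarrow> nat \<Rightarrow> nat \<Rightarrow> nat" where
  "cells_upto A s r c = card {d. d \<le> c \<and> entry A r d = Some s}"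

text \<open>
  Row-equivalent ptableaux have equally many cells with content \<open>s\<close> in row \<open>r\<close>. All of them are
  as far left (right) as possible if, for every \<open>c\<close>, as many (few) of them as possible lie in the
  first \<open>c\<close> columns. These counts determine a ptableau within its class.
\<close>

definition left_form :: "box_array \<Rightarrow> box_array" where
  "left_form T = (THE L. row_equiv T L \<and>
     (\<forall>T'. row_equiv T T' \<longrightarrow> (\<forall>s r c. cells_upto T' s r c \<le> cells_upto L s r c)))"

definition right_form :: "box_array \<Rightarrow> box_array" where
  "right_form T = (THE R. row_equiv T R \<and>
     (\<forall>T'. row_equiv T T' \<longrightarrow> (\<forall>s r c. cells_upto R s r c \<le> cells_upto T' s r c)))"

text \<open>0 if there are no cells.\<close>

definition largest_content :: "box_array \<Rightarrow> nat" where
  "largest_content T = Max (insert 0 (fst ` set_mset (cell_mset T)))"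

text \<open>
  The dual is determined only up to row-equivalence; \<open>is_dual T D\<close> says that \<open>D\<close> is a
  representative of it.
\<close>

definition is_dual :: "box_array \<Rightarrow> box_array \<Rightarrow> bool" where
  "is_dual T D \<longleftrightarrow> ptableau D \<and> nrows D = largest_content T \<and>
     cell_mset D = image_mset prod.swap (cell_mset T)"

end

theory Submission imports Defs begin

text \<open>
  Order the pairs (content, row) by \<open>(s, r) \<le> (s', r')\<close> iff \<open>s \<le> s'\<close> and \<open>r' \<le> r\<close>. The two
  conditions on a ptableau then say exactly that, whenever \<open>(s, r) < (s', r')\<close>, every cell \<open>s\<close> in
  row \<open>r\<close> lies in a column strictly to the left of every cell \<open>s'\<close> in row \<open>r'\<close>. Exchanging
  contents and rows reverses this order, so exchanging them and reversing the columns turns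
  arrangements of \<open>T\<close> into arrangements of its dual, with the same number of columns, and
  turns rightmost into leftmost. It remains to see that all minimal arrangements are
  row-equivalent: moving cells to the left one step at a time leads from each of them to the same
  arrangement, in which no cell can be moved.
\<close>

section \<open>The ptableau conditions as one order condition on pairs (content, row)\<close>

text \<open>Equal contents account for the strip condition, different contents for condition (b).
  Within one row the remaining case \<open>c = c'\<close> is impossible, since a box holds only one
  content.\<close>

lemma preptableau_iff:
  "preptableau A \<longleftrightarrow> is_array A \<and>
    (\<forall>r c s r' c' s'. entry A r c = Some s \<longrightarrow> entry A r' c' = Some s' \<longrightarrow> s \<le> s' \<longrightarrow> r' \<le> r \<longrightarrow>
       (s, r) \<noteq> (s', r') \<longrightarrow> c < c')"
  (is "_ \<longleftrightarrow> _ \<and> ?ord")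
proof -
  have ord: "?ord" if h: "\<And>i. horizontal_strip (cells_with_content A i)" and o: "content_ordered A"
  proof (intro allI impI)
    fix r c s r' c' s'
    assume e: "entry A r c = Some s" "entry A r' c' = Some s'" and "s \<le> s'" "r' \<le> r"
      and ne: "(s, r) \<noteq> (s', r')"
    show "c < c'"
    proof (cases "s = s'")
      case True
      then show ?thesis
        using h[of s] e ne \<open>r' \<le> r\<close>
        by (fastforce simp: horizontal_strip_def cells_with_content_def)
    next
      case False
      then have "s < s'"
        using \<open>s \<le> s'\<close> by simp
      then have "\<not> (r' < r \<and> c' \<le> c) \<and> \<not> (c' < c \<and> r' \<le> r)"
        using o e by (simp add: content_ordered_def cells_with_content_def)
      moreover have "c \<noteq> c'" if "r = r'"
        using e False that by auto
      ultimately show ?thesis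
        using \<open>r' \<le> r\<close> by linarith
    qed
  qed
  have h: "horizontal_strip (cells_with_content A i)" if ord: ?ord for i
    unfolding horizontal_strip_def
  proof clarify
    fix r c r' c' :: nat
    assume "(r, c) \<in> cells_with_content A i" "(r', c') \<in> cells_with_content A i" "r < r'"
    then show "c' < c"
      using ord[rule_format, of r' c' i r c i] by (simp add: cells_with_content_def)
  qed
  have o: "content_ordered A" if ord: ?ord
    unfolding content_ordered_def
  proof (intro allI impI)
    fix i j r c r' c' :: nat
    assume "i < j \<and> (r, c) \<in> cells_with_content A i \<and> (r', c') \<in> cells_with_content A j"
    then show "\<not> (r' < r \<and> c' \<le> c) \<and> \<not> (c' < c \<and> r' \<le> r)"
      using ord[rule_format, of r c i r' c' j] by (auto simp: cells_with_content_def)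
  qed
  show ?thesis
    unfolding preptableau_def
  proof (intro iffI; elim conjE)
    assume a: "is_array A" and b: "\<forall>i. horizontal_strip (cells_with_content A i)"
      and c: "content_ordered A"
    show "is_array A \<and> ?ord"
      using a ord[OF spec[OF b] c] by (rule conjI)
  next
    assume a: "is_array A" and b: ?ord
    show "is_array A \<and> (\<forall>i. horizontal_strip (cells_with_content A i)) \<and> content_ordered A"
      by (intro conjI allI a h[OF b] o[OF b])
  qed
qed

lemma preptableau_less:
  assumes "preptableau A" "entry A r c = Some s" "entry A r' c' = Some s'" "s \<le> s'" "r' \<le> r"
    "(s, r) \<noteq> (s', r')"
  shows "c < c'"
  using assms unfolding preptableau_iff by blast

lemma preptableau_bounds:
  assumes "preptableau A" "entry A r c = Some s"
  shows "1 \<le> r" "r \<le> nrows A" "1 \<le> c" "c \<le> ncols A" "1 \<le> s"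
  using assms unfolding preptableau_def is_array_def by blast+

section \<open>Counting cells by content and row\<close>

lemma finite_cells:
  assumes "is_array A"
  shows "finite (cells A)"
proof (rule finite_subset)
  show "cells A \<subseteq> {..nrows A} \<times> {..ncols A}"
    using assms unfolding is_array_def cells_def by auto
qed simp

lemma finite_entry:
  assumes "is_array A"
  shows "finite {d. entry A r d = Some s}"
  by (rule finite_subset[of _ "{..ncols A}"]) (use assms in \<open>auto simp: is_array_def\<close>)

lemma count_cell_mset:
  assumes "is_array A"
  shows "count (cell_mset A) (s, r) = card {d. entry A r d = Some s}"
proof -
  have "count (cell_mset A) (s, r) = card {x \<in> cells A. (s, r) = (\<lambda>(r, c). (the (entry A r c), r)) x}"
    unfolding cell_mset_def by (simp add: count_image_mset' finite_cells[OF assms])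
  also have "{x \<in> cells A. (s, r) = (\<lambda>(r, c). (the (entry A r c), r)) x}
      = Pair r ` {d. entry A r d = Some s}"
    by (auto simp: cells_def)
  also have "card \<dots> = card {d. entry A r d = Some s}"
    by (intro card_image inj_onI) simp
  finally show ?thesis .
qed

lemma cell_mset_eq_iff:
  assumes "is_array A" "is_array B"
  shows "cell_mset A = cell_mset B \<longleftrightarrow>
    (\<forall>s r. card {d. entry A r d = Some s} = card {d. entry B r d = Some s})"
  by (simp add: multiset_eq_iff count_cell_mset assms)

lemma in_cell_mset_iff:
  assumes "is_array A"
  shows "(s, r) \<in># cell_mset A \<longleftrightarrow> (\<exists>c. entry A r c = Some s)"
  by (simp add: count_cell_mset finite_entry assms flip: count_greater_zero_iff)
    (auto simp: card_gt_0_iff finite_entry assms)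

lemma cells_upto_Suc:
  "cells_upto A s r (Suc c) = cells_upto A s r c + (if entry A r (Suc c) = Some s then 1 else 0)"
proof -
  have "{d. d \<le> Suc c \<and> entry A r d = Some s} = {d. d \<le> c \<and> entry A r d = Some s} \<union>
      (if entry A r (Suc c) = Some s then {Suc c} else {})"
    by (auto simp: le_Suc_eq)
  then show ?thesis
    unfolding cells_upto_def by auto
qed

lemma cells_upto_0:
  assumes "is_array A"
  shows "cells_upto A s r 0 = 0"
  using assms unfolding cells_upto_def is_array_def by fastforce

lemma cells_upto_le_card:
  assumes "is_array A"
  shows "cells_upto A s r c \<le> card {d. entry A r d = Some s}"
  unfolding cells_upto_def by (intro card_mono finite_entry assms) auto

text \<open>The bridge from counts to positions: a subset of a finite set with full cardinality is
  the whole set.\<close>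

lemma cells_upto_eq_card_iff:
  assumes "is_array A"
  shows "cells_upto A s r c = card {d. entry A r d = Some s} \<longleftrightarrow>
    (\<forall>d. entry A r d = Some s \<longrightarrow> d \<le> c)"
proof
  assume "cells_upto A s r c = card {d. entry A r d = Some s}"
  then have "{d. d \<le> c \<and> entry A r d = Some s} = {d. entry A r d = Some s}"
    unfolding cells_upto_def by (intro card_subset_eq finite_entry assms) auto
  then show "\<forall>d. entry A r d = Some s \<longrightarrow> d \<le> c"
    by blast
next
  assume "\<forall>d. entry A r d = Some s \<longrightarrow> d \<le> c"
  then show "cells_upto A s r c = card {d. entry A r d = Some s}"
    unfolding cells_upto_def by (intro arg_cong[where f = card]) auto
qed

text \<open>The counts for two consecutive columns differ exactly where a cell sits, so they recover
  every box; column 0 is blank in both arrays.\<close>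

lemma array_eqI:
  fixes A B :: box_array
  assumes "is_array A" "is_array B" "nrows A = nrows B" "ncols A = ncols B"
    and upto: "\<And>s r c. cells_upto A s r c = cells_upto B s r c"
  shows "A = B"
proof -
  have "entry A r c = Some s \<longleftrightarrow> entry B r c = Some s" for r c s
  proof (cases c)
    case 0
    then show ?thesis
      using assms(1,2) unfolding is_array_def by fastforce
  next
    case (Suc d)
    then show ?thesis
      using upto[of s r "Suc d"] upto[of s r d] unfolding cells_upto_Suc
      by (auto split: if_splits)
  qed
  then have "entry A r c = entry B r c" for r c
    by (metis option.exhaust)
  then show ?thesis
    using assms by (intro box_array.equality) auto
qed

section \<open>Left-packed arrangements and their maximality\<close>

text \<open>A description of \<open>row_equiv\<close> by invariants instead of swaps;
  \<open>row_equiv_iff\<close> shows that the two agree on ptableaux.\<close>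

definition equivalent :: "box_array \<Rightarrow> box_array \<Rightarrow> bool" where
  "equivalent A B \<longleftrightarrow> ptableau A \<and> ptableau B \<and> nrows A = nrows B \<and> cell_mset A = cell_mset B"

lemma ptableau_preptableau: "ptableau A \<Longrightarrow> preptableau A"
  unfolding ptableau_def by blast

lemma preptableau_is_array: "preptableau A \<Longrightarrow> is_array A"
  unfolding preptableau_def by blast

lemma equivalent_ncols: "equivalent A B \<Longrightarrow> ncols A = ncols B"
  unfolding equivalent_def ptableau_def by (metis le_antisym)

lemma ptableau_same_ncols:
  assumes "ptableau A" "preptableau B" "nrows A = nrows B" "ncols A = ncols B"
    "cell_mset A = cell_mset B"
  shows "ptableau B"
  using assms unfolding ptableau_def by metis

text \<open>The local form of "as far left as possible": the cell in column \<open>c\<close> blocks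
  the move, because it fills the target box (\<open>r' = r\<close>) or must stay strictly to the
  left of the cell \<open>s\<close> (\<open>r < r'\<close>).\<close>

definition left_packed :: "box_array \<Rightarrow> bool" where
  "left_packed A \<longleftrightarrow> (\<forall>r c s. 1 \<le> c \<longrightarrow> entry A r (Suc c) = Some s \<longrightarrow>
     (\<exists>r' s'. entry A r' c = Some s' \<and> s' \<le> s \<and> r \<le> r'))"

text \<open>Local maximality implies global maximality. If \<open>A\<close> overtook
  \<open>L\<close> for the first time in some column, the blocker of a late cell of \<open>L\<close>
  would itself be late in \<open>L\<close> but early in \<open>A\<close>, against the induction
  hypothesis.\<close>

lemma left_packed_maximal:
  assumes L: "preptableau L" "left_packed L" and A: "preptableau A"
    and m: "cell_mset A = cell_mset L"
  shows "cells_upto A s r c \<le> cells_upto L s r c"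
proof (induction c arbitrary: s r)
  case 0
  show ?case
    using A L by (simp add: cells_upto_0 preptableau_is_array)
next
  case (Suc c)
  note array = preptableau_is_array[OF A] preptableau_is_array[OF L(1)]
  have total: "card {d. entry A r d = Some s} = card {d. entry L r d = Some s}" for s r
    using m by (simp add: cell_mset_eq_iff array)
  show ?case
  proof (rule ccontr)
    assume "\<not> ?thesis"
    then have eA: "entry A r (Suc c) = Some s" and nL: "entry L r (Suc c) \<noteq> Some s"
      and "cells_upto L s r (Suc c) < cells_upto A s r (Suc c)"
      using Suc.IH[of s r] by (auto simp: cells_upto_Suc split: if_splits)
    \<comment> \<open>The count of \<open>A\<close> is at most the common total, so \<open>L\<close>
      must have such a cell further right.\<close>
    then have "cells_upto L s r (Suc c) \<noteq> card {d. entry L r d = Some s}"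
      using cells_upto_le_card[OF array(1), of s r "Suc c"] total[of r s] by linarith
    then have ex: "\<exists>d. Suc c < d \<and> entry L r d = Some s"
      unfolding cells_upto_eq_card_iff[OF array(2)] by (meson not_less)
    \<comment> \<open>The first such cell of \<open>L\<close> after column \<open>Suc c\<close>. By
      this choice its blocker in column \<open>e\<close> cannot be another cell \<open>s\<close> in
      row \<open>r\<close>, so it belongs to a strictly smaller pair.\<close>
    define d where "d = (LEAST d. Suc c < d \<and> entry L r d = Some s)"
    have d: "Suc c < d" "entry L r d = Some s"
      using LeastI_ex[OF ex] unfolding d_def by blast+
    have least: "d \<le> e" if "Suc c < e" "entry L r e = Some s" for e
      using that unfolding d_def by (intro Least_le) blast
    obtain e where e: "d = Suc e" "c < e"
      using d(1) by (cases d) auto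
    then obtain r' s' where y: "entry L r' e = Some s'" "s' \<le> s" "r \<le> r'"
      using L(2) d unfolding left_packed_def by (metis One_nat_def Suc_leI gr_implies_not0 neq0_conv)
    have "(s', r') \<noteq> (s, r)"
    proof
      assume "(s', r') = (s, r)"
      then have "e \<noteq> Suc c" "entry L r e = Some s"
        using y nL by auto
      then show False
        using least[of e] e by simp
    qed
    \<comment> \<open>The smaller pair precedes column \<open>Suc c\<close> throughout
      \<open>A\<close>, hence also in \<open>L\<close> by induction; but \<open>L\<close> has such a
      cell in column \<open>e > c\<close>.\<close>
    then have "f \<le> c" if "entry A r' f = Some s'" for f
      using preptableau_less[OF A that eA] y by simp
    then have "cells_upto A s' r' c = card {d. entry A r' d = Some s'}"
      using cells_upto_eq_card_iff[OF array(1)] by blast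
    then have "cells_upto L s' r' c = card {d. entry L r' d = Some s'}"
      using Suc.IH[of s' r'] total[of r' s'] cells_upto_le_card[OF array(2), of s' r' c] by linarith
    then show False
      using cells_upto_eq_card_iff[OF array(2)] y(1) e(2) by fastforce
  qed
qed

section \<open>Moving one cell a single column to the left\<close>

definition move_left :: "box_array \<Rightarrow> nat \<Rightarrow> nat \<Rightarrow> box_array" where
  "move_left A r c =
     A\<lparr>entry := (entry A)(r := (entry A r)(Suc c := None, c := entry A r (Suc c)))\<rparr>"

lemma entry_move_left:
  "entry (move_left A r c) r' c' =
    (if r' = r \<and> c' = c then entry A r (Suc c)
     else if r' = r \<and> c' = Suc c then None else entry A r' c')"
  by (simp add: move_left_def)

lemma move_left_simps [simp]:
  "nrows (move_left A r c) = nrows A" "ncols (move_left A r c) = ncols A"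
  by (simp_all add: move_left_def)

text \<open>\<open>free\<close> is the failure of \<open>left_packed\<close> at one cell. Smaller
  pairs lie left of column \<open>Suc c\<close> and, by \<open>free\<close>, not in column
  \<open>c\<close>, so they stay to the left of the moved cell; larger pairs only get further away.
  The last claim is a termination measure.\<close>

lemma move_left:
  assumes A: "preptableau A" and e: "entry A r (Suc c) = Some s" and c: "1 \<le> c"
    and free: "\<nexists>r' s'. entry A r' c = Some s' \<and> s' \<le> s \<and> r \<le> r'"
  shows "entry A r c = None" "preptableau (move_left A r c)"
    "cell_mset (move_left A r c) = cell_mset A"
    "(\<Sum>x\<in>cells (move_left A r c). snd x) < (\<Sum>x\<in>cells A. snd x)"
proof -
  have array: "is_array A"
    using A by (rule preptableau_is_array)
  show none: "entry A r c = None"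
  proof (rule ccontr)
    assume "entry A r c \<noteq> None"
    then obtain s' where s': "entry A r c = Some s'"
      by blast
    then have "s < s'"
      using free by (metis le_refl not_less)
    then show False
      using preptableau_less[OF A e s'] by simp
  qed
  have array': "is_array (move_left A r c)"
    using array preptableau_bounds[OF A e] c unfolding is_array_def entry_move_left
    by (auto split: if_splits)
  have "c1 < c2"
    if e1: "entry (move_left A r c) r1 c1 = Some s1" and e2: "entry (move_left A r c) r2 c2 = Some s2"
      and le: "s1 \<le> s2" "r2 \<le> r1" "(s1, r1) \<noteq> (s2, r2)" for r1 c1 s1 r2 c2 s2
  proof -
    consider (both) "r1 = r" "c1 = c" "r2 = r" "c2 = c"
      | (first) "r1 = r" "c1 = c" "s1 = s" "entry A r2 c2 = Some s2"
      | (second) "r2 = r" "c2 = c" "s2 = s" "entry A r1 c1 = Some s1"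
      | (neither) "entry A r1 c1 = Some s1" "entry A r2 c2 = Some s2"
      using e1 e2 e unfolding entry_move_left by (auto split: if_splits)
    then show ?thesis
    proof cases
      case both
      then show ?thesis
        using e1 e2 le by auto
    next
      case first
      then show ?thesis
        using preptableau_less[OF A e first(4)] le by simp
    next
      case second
      then have "c1 < Suc c" "c1 \<noteq> c"
        using preptableau_less[OF A second(4) e] le free by auto
      then show ?thesis
        using second by simp
    next
      case neither
      then show ?thesis
        using preptableau_less[OF A neither] le by simp
    qed
  qed
  then show "preptableau (move_left A r c)"
    unfolding preptableau_iff using array' by blast
  show "cell_mset (move_left A r c) = cell_mset A"
  proof -
    have "card {d. entry (move_left A r c) r' d = Some s'} = card {d. entry A r' d = Some s'}" for r' s'
    proof (cases "r' = r \<and> s' = s")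
      case True
      have "{d. entry (move_left A r c) r d = Some s} = insert c ({d. entry A r d = Some s} - {Suc c})"
        using e by (auto simp: entry_move_left)
      moreover have "c \<notin> {d. entry A r d = Some s} - {Suc c}"
        using none by simp
      moreover have "Suc c \<in> {d. entry A r d = Some s}"
        using e by simp
      ultimately show ?thesis
        using True finite_entry[OF array, of r s]
        by (metis card_Suc_Diff1 card_insert_disjoint finite_Diff)
    next
      case False
      then have "{d. entry (move_left A r c) r' d = Some s'} = {d. entry A r' d = Some s'}"
        using e none by (auto simp: entry_move_left)
      then show ?thesis
        by simp
    qed
    then show ?thesis
      by (simp add: cell_mset_eq_iff array array')
  qed
  have "cells (move_left A r c) = insert (r, c) (cells A - {(r, Suc c)})"
    using e by (auto simp: cells_def entry_move_left split: if_splits)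
  moreover have "(r, c) \<notin> cells A - {(r, Suc c)}"
    using none by (simp add: cells_def)
  moreover have "(\<Sum>x\<in>cells A. snd x) = Suc c + (\<Sum>x\<in>cells A - {(r, Suc c)}. snd x)"
    using e finite_cells[OF array] by (subst sum.remove[of _ "(r, Suc c)"]) (auto simp: cells_def)
  ultimately show "(\<Sum>x\<in>cells (move_left A r c). snd x) < (\<Sum>x\<in>cells A. snd x)"
    using finite_cells[OF array] by simp
qed

lemma swap_stepI:
  assumes "ptableau A" "ptableau B" "nrows B = nrows A" "ncols B = ncols A"
    and "1 \<le> r" "r \<le> nrows A" "1 \<le> c" "c \<le> ncols A" "1 \<le> c'" "c' \<le> ncols A"
    and "c' = Suc c \<or> c = Suc c'" "entry A r c \<noteq> None" "entry A r c' = None"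
    and "entry B = (entry A)(r := (entry A r)(c := None, c' := entry A r c))"
  shows "swap_step A B"
  unfolding swap_step_def
  by (intro conjI assms(1-4), rule exI[of _ r], rule exI[of _ c], rule exI[of _ c'], intro conjI assms)

lemma move_left_swap_step:
  assumes "ptableau A" "entry A r (Suc c) = Some s" "1 \<le> c"
    "\<nexists>r' s'. entry A r' c = Some s' \<and> s' \<le> s \<and> r \<le> r'"
  shows "swap_step A (move_left A r c)"
proof -
  note A = ptableau_preptableau[OF assms(1)]
  note m = move_left[OF A assms(2-4)]
  have "ptableau (move_left A r c)"
    by (rule ptableau_same_ncols[OF assms(1) m(2)]) (simp_all add: m(3))
  then show ?thesis
  proof (rule swap_stepI[OF assms(1)])
    show "entry (move_left A r c) =
        (entry A)(r := (entry A r)(Suc c := None, c := entry A r (Suc c)))"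
      by (simp add: move_left_def)
  qed (use assms m(1) preptableau_bounds[OF A assms(2)] in auto)
qed

text \<open>Every possible move lowers the sum of the column numbers, so moving must end, and it can
  end only where no cell is movable.\<close>

lemma row_equiv_left_packed:
  assumes "ptableau A"
  shows "\<exists>L. row_equiv A L \<and> ptableau L \<and> left_packed L"
  using assms
proof (induction "\<Sum>x\<in>cells A. snd x" arbitrary: A rule: less_induct)
  case less
  show ?case
  proof (cases "left_packed A")
    case True
    then show ?thesis
      using less.prems unfolding row_equiv_def by blast
  next
    case False
    then obtain r c s where rcs: "1 \<le> c" "entry A r (Suc c) = Some s"
        "\<nexists>r' s'. entry A r' c = Some s' \<and> s' \<le> s \<and> r \<le> r'"
      unfolding left_packed_def by blast
    note step = move_left_swap_step[OF less.prems rcs(2,1,3)]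
    then have "ptableau (move_left A r c)"
      unfolding swap_step_def by blast
    then obtain L where "row_equiv (move_left A r c) L" "ptableau L" "left_packed L"
      using less.hyps move_left(4)[OF ptableau_preptableau[OF less.prems] rcs(2,1,3)] by blast
    then show ?thesis
      using step unfolding row_equiv_def by (meson converse_rtranclp_into_rtranclp)
  qed
qed

section \<open>Row-equivalence as equality of rows and cell multisets\<close>

lemma swap_step_sym:
  assumes "swap_step A B"
  shows "swap_step B A"
proof -
  obtain r c c' where *: "1 \<le> r" "r \<le> nrows A" "1 \<le> c" "c \<le> ncols A" "1 \<le> c'" "c' \<le> ncols A"
      "c' = Suc c \<or> c = Suc c'" "entry A r c \<noteq> None" "entry A r c' = None"
      and B: "entry B = (entry A)(r := (entry A r)(c := None, c' := entry A r c))"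
    using assms unfolding swap_step_def by blast
  have AB: "ptableau A" "ptableau B" "nrows B = nrows A" "ncols B = ncols A"
    using assms unfolding swap_step_def by blast+
  show ?thesis
  proof (rule swap_stepI[of B A r c' c])
    show "entry A = (entry B)(r := (entry B r)(c' := None, c := entry B r c'))"
      using * by (auto simp: B fun_eq_iff)
  qed (use * AB in \<open>auto simp: B\<close>)
qed

lemma row_equiv_sym: "row_equiv A B \<Longrightarrow> row_equiv B A"
  unfolding row_equiv_def
proof (induction rule: rtranclp_induct)
  case (step B C)
  then show ?case
    using swap_step_sym by (meson converse_rtranclp_into_rtranclp)
qed simp

lemma swap_step_cell_mset:
  assumes "swap_step A B"
  shows "cell_mset B = cell_mset A"
proof -
  have array: "is_array A" "is_array B"
    using assms unfolding swap_step_def by (simp_all add: ptableau_preptableau preptableau_is_array)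
  obtain r c c' where ne: "c \<noteq> c'" and e: "entry A r c \<noteq> None" "entry A r c' = None"
      and B: "entry B = (entry A)(r := (entry A r)(c := None, c' := entry A r c))"
    using assms unfolding swap_step_def by (metis n_not_Suc_n)
  \<comment> \<open>\<open>f r\<close> exchanges the two columns of the swap and is its own inverse;
    the other rows are left alone.\<close>
  define f where "f r' d = (if r' = r then if d = c then c' else if d = c' then c else d else d)" for r' d
  have "bij_betw (f r') {d. entry B r' d = Some s} {d. entry A r' d = Some s}" for r' s
    using ne e by (intro bij_betw_byWitness[of _ "f r'"]) (auto simp: f_def B split: if_splits)
  then have "card {d. entry B r' d = Some s} = card {d. entry A r' d = Some s}" for r' s
    by (rule bij_betw_same_card)
  then show ?thesis
    by (simp add: cell_mset_eq_iff array)
qed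

lemma row_equiv_imp_equivalent:
  assumes "row_equiv A B" "ptableau A"
  shows "equivalent A B"
  using assms(1) unfolding row_equiv_def
proof (induction rule: rtranclp_induct)
  case base
  then show ?case
    using assms(2) by (simp add: equivalent_def)
next
  case (step B C)
  then show ?case
    using swap_step_cell_mset[OF step.hyps(2)] unfolding equivalent_def swap_step_def by metis
qed

text \<open>Two left-packed arrangements dominate each other, so all their counts agree.\<close>

lemma left_packed_unique:
  assumes "equivalent A B" "left_packed A" "left_packed B"
  shows "A = B"
proof (rule array_eqI)
  show "cells_upto A s r c = cells_upto B s r c" for s r c
    using assms unfolding equivalent_def
    by (metis le_antisym left_packed_maximal ptableau_preptableau)
qed (use assms equivalent_ncols in
    \<open>auto simp: equivalent_def ptableau_preptableau preptableau_is_array\<close>)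

text \<open>Both arrangements can be moved to the same left-packed one, and the swaps from the
  second are then run backwards. This replaces reachability by a condition that passes easily to the
  dual.\<close>

lemma row_equiv_iff:
  assumes "ptableau A"
  shows "row_equiv A B \<longleftrightarrow> equivalent A B"
proof
  assume "row_equiv A B"
  then show "equivalent A B"
    using assms by (rule row_equiv_imp_equivalent)
next
  assume eq: "equivalent A B"
  then have B: "ptableau B"
    unfolding equivalent_def by blast
  obtain L where L: "row_equiv A L" "left_packed L"
    using row_equiv_left_packed[OF assms] by blast
  obtain L' where L': "row_equiv B L'" "left_packed L'"
    using row_equiv_left_packed[OF B] by blast
  have "equivalent L L'"
    using eq row_equiv_imp_equivalent[OF L(1) assms] row_equiv_imp_equivalent[OF L'(1) B]
    unfolding equivalent_def by metis
  then have "L = L'"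
    using L(2) L'(2) by (rule left_packed_unique)
  then show "row_equiv A B"
    using L(1) row_equiv_sym[OF L'(1)] unfolding row_equiv_def by (metis rtranclp_trans)
qed

section \<open>Characterising the justified forms\<close>

lemma equivalent_eqI:
  assumes "equivalent T A" "equivalent T B" "\<And>s r c. cells_upto A s r c = cells_upto B s r c"
  shows "A = B"
proof (rule array_eqI)
  show "ncols A = ncols B"
    using assms(1,2)[THEN equivalent_ncols] by simp
qed (use assms in \<open>auto simp: equivalent_def ptableau_preptableau preptableau_is_array\<close>)

text \<open>Uniqueness behind \<open>THE\<close>: two maximal arrangements have equal counts and
  therefore coincide.\<close>

lemma left_form_eqI:
  assumes "equivalent T L"
    "\<And>T' s r c. equivalent T T' \<Longrightarrow> cells_upto T' s r c \<le> cells_upto L s r c"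
  shows "left_form T = L"
proof -
  have T: "ptableau T"
    using assms(1) unfolding equivalent_def by blast
  show ?thesis
    unfolding left_form_def row_equiv_iff[OF T]
  proof (rule the_equality)
    fix L'
    assume "equivalent T L' \<and>
      (\<forall>T'. equivalent T T' \<longrightarrow> (\<forall>s r c. cells_upto T' s r c \<le> cells_upto L' s r c))"
    then show "L' = L"
      using assms by (intro equivalent_eqI[of T L' L]) (auto intro: le_antisym)
  qed (use assms in blast)
qed

lemma right_form_eqI:
  assumes "equivalent T R"
    "\<And>T' s r c. equivalent T T' \<Longrightarrow> cells_upto R s r c \<le> cells_upto T' s r c"
  shows "right_form T = R"
proof -
  have T: "ptableau T"
    using assms(1) unfolding equivalent_def by blast
  show ?thesis
    unfolding right_form_def row_equiv_iff[OF T]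
  proof (rule the_equality)
    fix R'
    assume "equivalent T R' \<and>
      (\<forall>T'. equivalent T T' \<longrightarrow> (\<forall>s r c. cells_upto R' s r c \<le> cells_upto T' s r c))"
    then show "R' = R"
      using assms by (intro equivalent_eqI[of T R' R]) (auto intro: le_antisym)
  qed (use assms in blast)
qed

text \<open>Existence of the maximum, attained at a left-packed arrangement. For
  \<open>right_form\<close>, existence comes from duality in
  \<open>right_form_eq_dual_left_form\<close>.\<close>

lemma left_form:
  assumes "ptableau T"
  shows "equivalent T (left_form T)"
    and "equivalent T T' \<Longrightarrow> cells_upto T' s r c \<le> cells_upto (left_form T) s r c"
proof -
  obtain L where "row_equiv T L" and L: "left_packed L"
    using row_equiv_left_packed[OF assms] by blast
  then have eq: "equivalent T L"
    using row_equiv_iff[OF assms] by blast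
  have max: "cells_upto T' s r c \<le> cells_upto L s r c" if "equivalent T T'" for T' s r c
    using left_packed_maximal[of L T'] that L eq unfolding equivalent_def
    by (simp add: ptableau_preptableau)
  have "left_form T = L"
    using eq max by (rule left_form_eqI)
  then show "equivalent T (left_form T)"
    and "equivalent T T' \<Longrightarrow> cells_upto T' s r c \<le> cells_upto (left_form T) s r c"
    using eq max by simp_all
qed

section \<open>The dual array: transposed pairs and reversed columns\<close>

text \<open>
  In a preptableau a content occurs at most once per column, so \<open>THE\<close> is well-defined here. The
  number of rows \<open>n\<close> is a parameter because it is not determined by the cells (blank rows).
\<close>

definition dual_array :: "nat \<Rightarrow> box_array \<Rightarrow> box_array" where
  "dual_array n A = \<lparr>nrows = n, ncols = ncols A, entry = (\<lambda>s k.
     if 1 \<le> k \<and> k \<le> ncols A \<and> (\<exists>t. entry A t (ncols A + 1 - k) = Some s)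
     then Some (THE t. entry A t (ncols A + 1 - k) = Some s) else None)\<rparr>"

lemma dual_array_simps [simp]: "nrows (dual_array n A) = n" "ncols (dual_array n A) = ncols A"
  by (simp_all add: dual_array_def)

text \<open>Two cells with equal content in different rows are comparable, so they cannot share a
  column; this makes the \<open>THE\<close> meaningful.\<close>

lemma entry_dual_array:
  assumes "preptableau A"
  shows "entry (dual_array n A) s k = Some t \<longleftrightarrow>
    1 \<le> k \<and> k \<le> ncols A \<and> entry A t (ncols A + 1 - k) = Some s"
proof -
  have unique: "t = t'" if "entry A t c = Some s" "entry A t' c = Some s" for t t' c
    using preptableau_less[OF assms that] preptableau_less[OF assms that(2,1)]
    by (metis le_cases less_irrefl order_refl prod.inject)
  have "(THE t. entry A t c = Some s) = t" if "entry A t c = Some s" for t c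
    using that unique by blast
  then show ?thesis
    unfolding dual_array_def by auto
qed

text \<open>The order on pairs and the order of the columns are both reversed, so the order
  condition survives. The bound \<open>n\<close> is there because contents become row
  numbers.\<close>

lemma preptableau_dual_array:
  assumes A: "preptableau A" and n: "\<And>s r. (s, r) \<in># cell_mset A \<Longrightarrow> s \<le> n"
  shows "preptableau (dual_array n A)"
proof -
  have "s \<le> n" if "entry A r c = Some s" for r c s
    using n that in_cell_mset_iff[OF preptableau_is_array[OF A]] by blast
  then have "is_array (dual_array n A)"
    unfolding is_array_def entry_dual_array[OF A] using preptableau_bounds[OF A] by auto
  moreover have "c < c'" if "entry (dual_array n A) r c = Some s"
    "entry (dual_array n A) r' c' = Some s'" "s \<le> s'" "r' \<le> r" "(s, r) \<noteq> (s', r')"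
    for r c s r' c' s'
  proof -
    have "ncols A + 1 - c' < ncols A + 1 - c"
      using that preptableau_less[OF A, of s' "ncols A + 1 - c'" r' s "ncols A + 1 - c" r]
      unfolding entry_dual_array[OF A] by auto
    then show ?thesis
      by linarith
  qed
  ultimately show ?thesis
    unfolding preptableau_iff by blast
qed

text \<open>Reflection matches the first \<open>c\<close> columns with the last \<open>c\<close>.
  For \<open>c\<close> beyond \<open>ncols A\<close> the truncated difference is 0 and every column
  is included.\<close>

lemma entries_dual_array:
  assumes A: "preptableau A"
  shows "{d. d \<le> c \<and> entry (dual_array n A) r d = Some s} =
    (\<lambda>d. ncols A + 1 - d) ` {d. ncols A - c < d \<and> entry A s d = Some r}"
proof (intro equalityI subsetI)
  fix d
  assume "d \<in> {d. d \<le> c \<and> entry (dual_array n A) r d = Some s}"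
  then show "d \<in> (\<lambda>d. ncols A + 1 - d) ` {d. ncols A - c < d \<and> entry A s d = Some r}"
    by (intro image_eqI[of _ _ "ncols A + 1 - d"]) (auto simp: entry_dual_array[OF A])
next
  fix d
  assume "d \<in> (\<lambda>d. ncols A + 1 - d) ` {d. ncols A - c < d \<and> entry A s d = Some r}"
  then obtain e where e: "d = ncols A + 1 - e" "ncols A - c < e" "entry A s e = Some r"
    by blast
  moreover have "1 \<le> e" "e \<le> ncols A"
    using preptableau_bounds[OF A e(3)] by blast+
  ultimately show "d \<in> {d. d \<le> c \<and> entry (dual_array n A) r d = Some s}"
    by (auto simp: entry_dual_array[OF A])
qed

text \<open>Counting in the last columns means subtracting from the total, and this change of sign
  is what exchanges leftmost and rightmost.\<close>

lemma cells_upto_dual_array: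
  assumes A: "preptableau A"
  shows "cells_upto (dual_array n A) s r c =
    card {d. entry A s d = Some r} - cells_upto A r s (ncols A - c)"
proof -
  have "cells_upto (dual_array n A) s r c = card {d. ncols A - c < d \<and> entry A s d = Some r}"
    unfolding cells_upto_def entries_dual_array[OF A]
  proof (rule card_image, rule inj_onI)
    fix d e
    assume "d \<in> {d. ncols A - c < d \<and> entry A s d = Some r}"
      "e \<in> {d. ncols A - c < d \<and> entry A s d = Some r}" "ncols A + 1 - d = ncols A + 1 - e"
    \<comment> \<open>Truncated subtraction is injective here thanks to the bound on the
      columns.\<close>
    then show "d = e"
      using preptableau_bounds(4)[OF A, of s d r] preptableau_bounds(4)[OF A, of s e r] by auto
  qed
  also have "{d. ncols A - c < d \<and> entry A s d = Some r} =
      {d. entry A s d = Some r} - {d. d \<le> ncols A - c \<and> entry A s d = Some r}"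
    by auto
  also have "card \<dots> = card {d. entry A s d = Some r} - cells_upto A r s (ncols A - c)"
    unfolding cells_upto_def
    by (rule card_Diff_subset) (auto simp: finite_entry preptableau_is_array[OF A])
  finally show ?thesis .
qed

lemma count_image_mset_swap: "count (image_mset prod.swap M) (r, s) = count M (s, r)"
  by (induction M) auto

lemma cell_mset_dual_array:
  assumes A: "preptableau A" and n: "\<And>s r. (s, r) \<in># cell_mset A \<Longrightarrow> s \<le> n"
  shows "cell_mset (dual_array n A) = image_mset prod.swap (cell_mset A)"
proof (rule multiset_eqI)
  fix x :: "nat \<times> nat"
  obtain s r where x: "x = (s, r)"
    by (cases x)
  have D: "is_array (dual_array n A)"
    using preptableau_dual_array[OF A n] by (rule preptableau_is_array)
  note array = preptableau_is_array[OF A]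
  \<comment> \<open>The total is written as the count up to the last column, so that the reflected
    formula subtracts the count up to column 0.\<close>
  have "count (cell_mset (dual_array n A)) (s, r) = cells_upto (dual_array n A) s r (ncols A)"
    using D unfolding count_cell_mset[OF D]
    by (subst eq_commute, subst cells_upto_eq_card_iff) (auto simp: is_array_def)
  also have "\<dots> = card {d. entry A s d = Some r}"
    by (simp add: cells_upto_dual_array[OF A] cells_upto_0[OF array])
  also have "\<dots> = count (cell_mset A) (r, s)"
    by (simp add: count_cell_mset[OF array])
  also have "\<dots> = count (image_mset prod.swap (cell_mset A)) (s, r)"
    by (simp add: count_image_mset_swap)
  finally show "count (cell_mset (dual_array n A)) x = count (image_mset prod.swap (cell_mset A)) x"
    by (simp add: x)
qed

section \<open>Minimal numbers of columns under duality\<close>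

lemma image_mset_swap_swap: "image_mset prod.swap (image_mset prod.swap M) = M"
  by (simp add: multiset.map_comp)

lemma content_le_largest_content: "(s, r) \<in># cell_mset T \<Longrightarrow> s \<le> largest_content T"
  unfolding largest_content_def by (intro Max_ge) force+

lemma row_le_nrows:
  assumes "preptableau A" "(s, r) \<in># cell_mset A"
  shows "r \<le> nrows A"
  using assms preptableau_bounds(2) in_cell_mset_iff[OF preptableau_is_array] by blast

text \<open>Dualising \<open>A\<close> yields an arrangement of the cells of \<open>T\<close> with
  as many columns as \<open>A\<close>, to which the minimality of \<open>T\<close> applies. Taking
  \<open>nrows T\<close> restores the blank rows of \<open>T\<close>.\<close>

lemma ncols_le_dual:
  assumes T: "ptableau T" and A: "preptableau A" and m: "cell_mset A = image_mset prod.swap (cell_mset T)"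
  shows "ncols T \<le> ncols A"
proof -
  have n: "s \<le> nrows T" if "(s, r) \<in># cell_mset A" for s r
    using that row_le_nrows[OF ptableau_preptableau[OF T]] unfolding m by auto
  have "preptableau (dual_array (nrows T) A)"
    using A n by (rule preptableau_dual_array)
  moreover have "cell_mset (dual_array (nrows T) A) = cell_mset T"
    using cell_mset_dual_array[OF A n] by (simp add: m image_mset_swap_swap)
  ultimately show ?thesis
    using T unfolding ptableau_def by (metis dual_array_simps)
qed

text \<open>Any competitor has the transposed cells of \<open>T\<close>, so
  \<open>ncols_le_dual\<close> bounds its number of columns from below.\<close>

lemma ptableau_dual_array:
  assumes "ptableau T" "\<And>s r. (s, r) \<in># cell_mset T \<Longrightarrow> s \<le> n"
  shows "ptableau (dual_array n T)"
  unfolding ptableau_def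
  using assms ncols_le_dual[OF assms(1)]
  by (auto simp: preptableau_dual_array cell_mset_dual_array ptableau_preptableau)

lemma is_dual_dual_array:
  assumes "ptableau T"
  shows "is_dual T (dual_array (largest_content T) T)"
  unfolding is_dual_def using assms content_le_largest_content
  by (auto simp: ptableau_dual_array cell_mset_dual_array ptableau_preptableau)

text \<open>Transposing pairs is an involution, so \<open>ncols_le_dual\<close> applies in both
  directions.\<close>

lemma is_dual_ncols:
  assumes "ptableau T" "is_dual T D"
  shows "ncols D = ncols T"
proof (rule le_antisym)
  have D: "ptableau D" "cell_mset D = image_mset prod.swap (cell_mset T)"
    using assms(2) unfolding is_dual_def by blast+
  show "ncols D \<le> ncols T"
    using ncols_le_dual[OF D(1) ptableau_preptableau[OF assms(1)]]
    by (simp add: D(2) image_mset_swap_swap)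
  show "ncols T \<le> ncols D"
    using ncols_le_dual[OF assms(1) ptableau_preptableau[OF D(1)] D(2)] .
qed

section \<open>The right-justified form as the dual of a left-justified one\<close>

text \<open>Each arrangement of \<open>T\<close> reflects to one of \<open>D\<close>, whose counts
  \<open>left_form D\<close> dominates. Reflecting back reverses the inequality, so the counts
  become smallest.\<close>

lemma right_form_eq_dual_left_form:
  assumes T: "ptableau T" and D: "is_dual T D"
  shows "right_form T = dual_array (nrows T) (left_form D)"
proof -
  define L where "L = left_form D"
  have D': "ptableau D" "nrows D = largest_content T" "cell_mset D = image_mset prod.swap (cell_mset T)"
    using D unfolding is_dual_def by blast+
  have eq: "equivalent D L"
    and max: "\<And>D' s r c. equivalent D D' \<Longrightarrow> cells_upto D' s r c \<le> cells_upto L s r c"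
    using left_form[OF D'(1)] unfolding L_def by blast+
  have L: "ptableau L" "cell_mset L = image_mset prod.swap (cell_mset T)" "ncols L = ncols T"
    using eq D'(3) equivalent_ncols[OF eq] is_dual_ncols[OF T D] unfolding equivalent_def by simp_all
  note preL = ptableau_preptableau[OF L(1)]
  have n: "s \<le> nrows T" if "(s, r) \<in># cell_mset L" for s r
    using that row_le_nrows[OF ptableau_preptableau[OF T]] unfolding L by auto
  have "right_form T = dual_array (nrows T) L"
  proof (rule right_form_eqI)
    show "equivalent T (dual_array (nrows T) L)"
      using ptableau_dual_array[OF L(1) n] cell_mset_dual_array[OF preL n] T
      by (simp add: equivalent_def L image_mset_swap_swap)
  next
    fix T' s r c
    assume T': "equivalent T T'"
    \<comment> \<open>The arrangement of \<open>D\<close> corresponding to the competitor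
      \<open>T'\<close>.\<close>
    define E where "E = dual_array (largest_content T) T'"
    have pT': "ptableau T'" and m: "cell_mset T' = cell_mset T"
      using T' unfolding equivalent_def by simp_all
    note preT' = ptableau_preptableau[OF pT']
    have N: "s \<le> largest_content T" if "(s, r) \<in># cell_mset T'" for s r
      using that content_le_largest_content unfolding m by blast
    have E: "equivalent D E"
      using ptableau_dual_array[OF pT' N] cell_mset_dual_array[OF preT' N] D'
      by (simp add: equivalent_def E_def m)
    have "count (cell_mset L) (r, s) = count (cell_mset T') (s, r)"
      by (simp add: L(2) m count_image_mset_swap)
    then have total: "card {d. entry L s d = Some r} = card {d. entry T' r d = Some s}"
      by (simp add: count_cell_mset preptableau_is_array preL preT')
    have "ncols T' = ncols T"
      using equivalent_ncols[OF T'] by simp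
    then have "card {d. entry T' r d = Some s} - cells_upto T' s r (ncols T - (ncols T - c))
        \<le> cells_upto L r s (ncols T - c)"
      using max[OF E, of r s "ncols T - c"] unfolding E_def cells_upto_dual_array[OF preT'] by simp
    \<comment> \<open>The double truncated difference is the minimum of \<open>c\<close> and
      \<open>ncols T\<close>; monotonicity handles \<open>c\<close> beyond the last column.\<close>
    moreover have "cells_upto T' s r (ncols T - (ncols T - c)) \<le> cells_upto T' s r c"
      unfolding cells_upto_def by (intro card_mono) auto
    ultimately show "cells_upto (dual_array (nrows T) L) s r c \<le> cells_upto T' s r c"
      unfolding cells_upto_dual_array[OF preL] total L(3) by linarith
  qed
  then show ?thesis
    unfolding L_def .
qed

theorem theorem2p23:
  fixes T :: box_array and n l :: nat
  assumes "ptableau T" and "nrows T = n" and "ncols T = l"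
  shows "(\<exists>D. is_dual T D) \<and>
    (\<forall>D. is_dual T D \<longrightarrow>
       ncols D = l \<and>
       (\<forall>k. 1 \<le> k \<and> k \<le> l \<longrightarrow>
          (\<forall>s t. entry (right_form T) t (l - k + 1) = Some s \<longleftrightarrow>
                 entry (left_form D) s k = Some t)))"
proof (intro conjI allI impI)
  show "\<exists>D. is_dual T D"
    using is_dual_dual_array[OF assms(1)] by blast
next
  fix D
  assume "is_dual T D"
  then show "ncols D = l"
    using is_dual_ncols assms by blast
next
  fix D k s t
  assume D: "is_dual T D" and k: "1 \<le> k \<and> k \<le> l"
  have "equivalent D (left_form D)"
    using left_form(1) D unfolding is_dual_def by blast
  then have "preptableau (left_form D)" "ncols (left_form D) = l"
    using equivalent_ncols is_dual_ncols[OF assms(1) D] assms(3) ptableau_preptableau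
    unfolding equivalent_def by metis+
  \<comment> \<open>Since \<open>1 \<le> k\<close> and \<open>k \<le> l\<close>, reflecting column
    \<open>l - k + 1\<close> gives \<open>l + 1 - (l - k + 1) = k\<close>.\<close>
  then show "entry (right_form T) t (l - k + 1) = Some s \<longleftrightarrow> entry (left_form D) s k = Some t"
    using k by (auto simp: right_form_eq_dual_left_form[OF assms(1) D] entry_dual_array)
qed

end
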